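(* Let $k$ be an algebraically closed field, let $d\geq 0$ be an integer, and let $(\mathcal{T},\mathcal{T}^p,\mathcal{S})$ be a $(-d)$-Calabi-Yau triple over $k$. Let $X$ and $Y$ be objects in $\mathcal{S}$. Then $(\mathcal{T}/\mathcal{T}^p)(\Sigma^jY,X)=0$ for $1\leq j\leq d$.
   Context: Conventions. $\mathcal{T}(X,Y)$ denotes the Hom-space in $\mathcal{T}$, $\Sigma$ is the suspension, $D=\mathrm{Hom}_k(-,k)$. For a subcategory (or collection of objects) $\mathcal{X}$ of $\mathcal{T}$: $\mathcal{X}^\perp=\{T\mid\mathcal{T}(\mathcal{X},T)=0\}$, ${}^\perp\mathcal{X}=\{T\mid\mathcal{T}(T,\mathcal{X})=0\}$. $\mathcal{X}*\mathcal{Y}$ is the full subcategory of objects $T$ fitting in a triangle $X\to T\to Y\to\Sigma X$ with $X\in\mathcal{X}$, $Y\in\mathcal{Y}$; if $\mathcal{T}(\mathcal{X},\mathcal{Y})=0$ it is written $\mathcal{X}\perp\mathcal{Y}$. $\Sigma^{\geq 0}\mathcal{S}$ means $\{\Sigma^m S\mid m\geq 0,\ S\in\mathcal{S}\}$, and similarly for $\Sigma^{<0}\mathcal{S}$. A torsion pair is a pair $(\mathcal{A},\mathcal{B})$ of full subcategories closed under direct summands with $\mathcal{T}=\mathcal{A}\perp\mathcal{B}$; a co-$t$-structure is a torsion pair with $\Sigma^{-1}\mathcal{A}\subseteq\mathcal{A}$ (equivalently $\Sigma\mathcal{B}\subseteq\mathcal{B}$). Simple minded collection (SMC). In a $k$-linear,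 Hom-finite, Krull-Schmidt triangulated category $\mathcal{T}$, a collection $\mathcal{S}$ is an SMC if for all $X,Y\in\mathcal{S}$: $\mathcal{T}(X,\Sigma^{m}Y)=0$ for all $m<0$; $\dim_k\mathcal{T}(X,Y)=\delta_{XY}$; and $\mathrm{thick}(\mathcal{S})=\mathcal{T}$. $(-d)$-Calabi-Yau triple $(\mathcal{T},\mathcal{T}^p,\mathcal{S})$: (RS0) $\mathcal{T}$ is a $k$-linear, Hom-finite, Krull-Schmidt triangulated category and $\mathcal{T}^p$ is a thick subcategory of $\mathcal{T}$; (RS1) with $\mathbb{S}=\Sigma^{-d}$, there is a bifunctorial isomorphism $D\mathcal{T}(X,Y)\cong\mathcal{T}(Y,\mathbb{S}X)$ for $X\in\mathcal{T}^p$, $Y\in\mathcal{T}$; (RS2) $\mathcal{S}$ is an SMC in $\mathcal{T}$, and $\mathcal{T}={}^\perp(\Sigma^{\geq 0}\mathcal{S})\perp{}^\perp(\Sigma^{<0}\mathcal{S})=(\Sigma^{\geq 0}\mathcal{S})^\perp\perp(\Sigma^{<0}\mathcal{S})^\perp$ are co-$t$-structures on $\mathcal{T}$ with ${}^\perp(\Sigma^{\geq 0}\mathcal{S})\subset\mathcal{T}^p$ and $(\Sigma^{<0}\mathcal{S})^\perp\subset\mathcal{T}^p$. $\mathcal{T}/\mathcal{T}^p$ denotes the Verdier quotient, which has the same objects as $\mathcal{T}$. *)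

theory Defs
  imports "HOL-Computational_Algebra.Polynomial" "HOL-Library.FuncSet"
begin

section \<open>Linear categories with a suspension and a class of triangles\<close>

text \<open>
  The objects are the elements of the type \<open>'o\<close>. All Hom-spaces are \<open>'k\<close>-linear subspaces of one
  ambient vector space \<open>'m\<close>, and composition, suspension and its quasi-inverse on morphisms are
  operations on \<open>'m\<close> about which something is assumed only for composable, respectively well-typed,
  arguments. Any \<open>'k\<close>-linear category is of this form: take for \<open>'m\<close> the direct sum of all its
  Hom-spaces, extending the operations by linearity and by \<open>0\<close>. Different Hom-spaces may
  overlap (they all contain \<open>0\<close>), so wherever source and target matter they are given explicitly.
\<close>

record ('k, 'o, 'm) tricat =
  Hom :: "'o \<Rightarrow> 'o \<Rightarrow> 'm set"
  cmp :: "'m \<Rightarrow> 'm \<Rightarrow> 'm"  (infixl "\<cdot>\<index>" 70)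
  idt :: "'o \<Rightarrow> 'm"
  scl :: "'k \<Rightarrow> 'm \<Rightarrow> 'm"
  susO :: "'o \<Rightarrow> 'o"
  susM :: "'m \<Rightarrow> 'm"
  desO :: "'o \<Rightarrow> 'o"
  desM :: "'m \<Rightarrow> 'm"
  tri :: "('o \<times> 'o \<times> 'o \<times> 'm \<times> 'm \<times> 'm) set"

text \<open>
  \<open>g \<cdot> f\<close> is \<open>g\<close> after \<open>f\<close>; \<open>sus\<close> is the suspension, \<open>des\<close> (desuspension) its quasi-inverse;
  \<open>(X, Y, Z, f, g, h) \<in> tri T\<close> stands for a triangle
  \<open>X \<rightarrow>\<^sup>f Y \<rightarrow>\<^sup>g Z \<rightarrow>\<^sup>h susO T X\<close>.
\<close>

locale linear_category = vector_space "scl T"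
  for T :: "('k::field, 'o, 'm::ab_group_add, 'z) tricat_scheme" (structure) +
  assumes Hom_subspace: "subspace (Hom T X Y)"
    and cmp_in_Hom: "f \<in> Hom T X Y \<Longrightarrow> g \<in> Hom T Y Z \<Longrightarrow> g \<cdot> f \<in> Hom T X Z"
    and idt_in_Hom: "idt T X \<in> Hom T X X"
    and cmp_assoc: "f \<in> Hom T W X \<Longrightarrow> g \<in> Hom T X Y \<Longrightarrow> h \<in> Hom T Y Z \<Longrightarrow>
      h \<cdot> (g \<cdot> f) = (h \<cdot> g) \<cdot> f"
    and cmp_idt_left: "f \<in> Hom T X Y \<Longrightarrow> idt T Y \<cdot> f = f"
    and cmp_idt_right: "f \<in> Hom T X Y \<Longrightarrow> f \<cdot> idt T X = f"
    and cmp_add_left: "f \<in> Hom T X Y \<Longrightarrow> g \<in> Hom T Y Z \<Longrightarrow> g' \<in> Hom T Y Z \<Longrightarrow>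
      (g + g') \<cdot> f = g \<cdot> f + g' \<cdot> f"
    and cmp_add_right: "f \<in> Hom T X Y \<Longrightarrow> f' \<in> Hom T X Y \<Longrightarrow> g \<in> Hom T Y Z \<Longrightarrow>
      g \<cdot> (f + f') = g \<cdot> f + g \<cdot> f'"
    and cmp_scl_left: "f \<in> Hom T X Y \<Longrightarrow> g \<in> Hom T Y Z \<Longrightarrow>
      scl T c g \<cdot> f = scl T c (g \<cdot> f)"
    and cmp_scl_right: "f \<in> Hom T X Y \<Longrightarrow> g \<in> Hom T Y Z \<Longrightarrow>
      g \<cdot> scl T c f = scl T c (g \<cdot> f)"

definition iso_mor :: "('k, 'o, 'm::ab_group_add, 'z) tricat_scheme \<Rightarrow> 'o \<Rightarrow> 'o \<Rightarrow> 'm \<Rightarrow> bool" where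
  "iso_mor T X Y f \<longleftrightarrow> f \<in> Hom T X Y \<and>
     (\<exists>g \<in> Hom T Y X. g \<cdot>\<^bsub>T\<^esub> f = idt T X \<and> f \<cdot>\<^bsub>T\<^esub> g = idt T Y)"

definition zero_object :: "('k, 'o, 'm::ab_group_add, 'z) tricat_scheme \<Rightarrow> 'o \<Rightarrow> bool" where
  "zero_object T X \<longleftrightarrow> (\<forall>Y. Hom T X Y = {0} \<and> Hom T Y X = {0})"

text \<open>\<open>X\<close> is a biproduct of the list \<open>Xs\<close>; for the empty list this says that \<open>X\<close> is a zero object.\<close>

definition direct_sum ::
    "('k, 'o, 'm::ab_group_add, 'z) tricat_scheme \<Rightarrow> 'o \<Rightarrow> 'o list \<Rightarrow> bool" where
  "direct_sum T X Xs \<longleftrightarrow> (\<exists>(\<iota> :: nat \<Rightarrow> 'm) (\<pi> :: nat \<Rightarrow> 'm).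
     (\<forall>i < length Xs. \<iota> i \<in> Hom T (Xs ! i) X \<and> \<pi> i \<in> Hom T X (Xs ! i)) \<and>
     (\<forall>i < length Xs. \<forall>j < length Xs.
        \<pi> i \<cdot>\<^bsub>T\<^esub> \<iota> j = (if i = j then idt T (Xs ! i) else 0)) \<and>
     (\<Sum>i < length Xs. \<iota> i \<cdot>\<^bsub>T\<^esub> \<pi> i) = idt T X)"

definition linear_endofunctor ::
    "('k, 'o, 'm::ab_group_add, 'z) tricat_scheme \<Rightarrow> ('o \<Rightarrow> 'o) \<Rightarrow> ('m \<Rightarrow> 'm) \<Rightarrow> bool" where
  "linear_endofunctor T FO FM \<longleftrightarrow>
     (\<forall>X. FM (idt T X) = idt T (FO X)) \<and>
     (\<forall>X Y. \<forall>f \<in> Hom T X Y. FM f \<in> Hom T (FO X) (FO Y)) \<and>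
     (\<forall>X Y Z. \<forall>f \<in> Hom T X Y. \<forall>g \<in> Hom T Y Z. FM (g \<cdot>\<^bsub>T\<^esub> f) = FM g \<cdot>\<^bsub>T\<^esub> FM f) \<and>
     (\<forall>X Y. \<forall>f \<in> Hom T X Y. \<forall>g \<in> Hom T X Y. FM (f + g) = FM f + FM g) \<and>
     (\<forall>X Y c. \<forall>f \<in> Hom T X Y. FM (scl T c f) = scl T c (FM f))"

definition naturally_isomorphic ::
    "('k, 'o, 'm::ab_group_add, 'z) tricat_scheme \<Rightarrow>
     ('o \<Rightarrow> 'o) \<Rightarrow> ('m \<Rightarrow> 'm) \<Rightarrow> ('o \<Rightarrow> 'o) \<Rightarrow> ('m \<Rightarrow> 'm) \<Rightarrow> bool" where
  "naturally_isomorphic T FO FM GO GM \<longleftrightarrow> (\<exists>\<alpha> :: 'o \<Rightarrow> 'm.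
     (\<forall>X. iso_mor T (FO X) (GO X) (\<alpha> X)) \<and>
     (\<forall>X Y. \<forall>f \<in> Hom T X Y. \<alpha> Y \<cdot>\<^bsub>T\<^esub> FM f = GM f \<cdot>\<^bsub>T\<^esub> \<alpha> X))"

text \<open>\<open>shiftO T m\<close> and \<open>shiftM T m\<close> form the functor \<open>\<Sigma>\<^sup>m\<close>.\<close>

definition shiftO :: "('k, 'o, 'm, 'z) tricat_scheme \<Rightarrow> int \<Rightarrow> 'o \<Rightarrow> 'o" where
  "shiftO T m = (if 0 \<le> m then susO T ^^ nat m else desO T ^^ nat (- m))"

definition shiftM :: "('k, 'o, 'm, 'z) tricat_scheme \<Rightarrow> int \<Rightarrow> 'm \<Rightarrow> 'm" where
  "shiftM T m = (if 0 \<le> m then susM T ^^ nat m else desM T ^^ nat (- m))"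


section \<open>Triangulated categories\<close>

locale triangulated_category = linear_category T
  for T :: "('k::field, 'o, 'm::ab_group_add, 'z) tricat_scheme" (structure) +
  assumes direct_sum_exists: "\<exists>X. direct_sum T X Xs"
    and sus_functor: "linear_endofunctor T (susO T) (susM T)"
    and des_functor: "linear_endofunctor T (desO T) (desM T)"
    and sus_des: "naturally_isomorphic T (susO T \<circ> desO T) (susM T \<circ> desM T) id id"
    and des_sus: "naturally_isomorphic T (desO T \<circ> susO T) (desM T \<circ> susM T) id id"
    and tri_in_Hom: "(X, Y, Z, f, g, h) \<in> tri T \<Longrightarrow>
      f \<in> Hom T X Y \<and> g \<in> Hom T Y Z \<and> h \<in> Hom T Z (susO T X)"
    and tri_iso: "(X, Y, Z, f, g, h) \<in> tri T \<Longrightarrow>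
      f' \<in> Hom T X' Y' \<Longrightarrow> g' \<in> Hom T Y' Z' \<Longrightarrow> h' \<in> Hom T Z' (susO T X') \<Longrightarrow>
      iso_mor T X X' a \<Longrightarrow> iso_mor T Y Y' b \<Longrightarrow> iso_mor T Z Z' c \<Longrightarrow>
      b \<cdot> f = f' \<cdot> a \<Longrightarrow> c \<cdot> g = g' \<cdot> b \<Longrightarrow> susM T a \<cdot> h = h' \<cdot> c \<Longrightarrow>
      (X', Y', Z', f', g', h') \<in> tri T"
    and tri_idt: "zero_object T Z \<Longrightarrow> (X, X, Z, idt T X, 0, 0) \<in> tri T"
    and tri_cone: "f \<in> Hom T X Y \<Longrightarrow> \<exists>Z g h. (X, Y, Z, f, g, h) \<in> tri T"
    and tri_rotate: "f \<in> Hom T X Y \<Longrightarrow> g \<in> Hom T Y Z \<Longrightarrow> h \<in> Hom T Z (susO T X) \<Longrightarrow>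
      (X, Y, Z, f, g, h) \<in> tri T \<longleftrightarrow> (Y, Z, susO T X, g, h, - susM T f) \<in> tri T"
    and tri_morphism: "(X, Y, Z, f, g, h) \<in> tri T \<Longrightarrow> (X', Y', Z', f', g', h') \<in> tri T \<Longrightarrow>
      a \<in> Hom T X X' \<Longrightarrow> b \<in> Hom T Y Y' \<Longrightarrow> b \<cdot> f = f' \<cdot> a \<Longrightarrow>
      \<exists>c \<in> Hom T Z Z'. c \<cdot> g = g' \<cdot> b \<and> susM T a \<cdot> h = h' \<cdot> c"
    and tri_octahedron: "(X, Y, U, f, p, q) \<in> tri T \<Longrightarrow> (Y, Z, W, g, r, s) \<in> tri T \<Longrightarrow>
      (X, Z, V, g \<cdot> f, t, u) \<in> tri T \<Longrightarrow>
      \<exists>a \<in> Hom T U V. \<exists>b \<in> Hom T V W. (U, V, W, a, b, susM T p \<cdot> s) \<in> tri T \<and>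
        a \<cdot> p = t \<cdot> g \<and> u \<cdot> a = q \<and> b \<cdot> t = r \<and> s \<cdot> b = susM T f \<cdot> u"

definition Hom_finite :: "('k::field, 'o, 'm::ab_group_add, 'z) tricat_scheme \<Rightarrow> bool" where
  "Hom_finite T \<longleftrightarrow> (\<forall>X Y. \<exists>B. finite B \<and> Hom T X Y = module.span (scl T) B)"

text \<open>The endomorphism ring is local: it is nonzero and its non-units are closed under addition.\<close>

definition local_End :: "('k, 'o, 'm::ab_group_add, 'z) tricat_scheme \<Rightarrow> 'o \<Rightarrow> bool" where
  "local_End T X \<longleftrightarrow> idt T X \<noteq> 0 \<and>
     (\<forall>f \<in> Hom T X X. \<forall>g \<in> Hom T X X.
        \<not> iso_mor T X X f \<longrightarrow> \<not> iso_mor T X X g \<longrightarrow> \<not> iso_mor T X X (f + g))"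

definition Krull_Schmidt :: "('k, 'o, 'm::ab_group_add, 'z) tricat_scheme \<Rightarrow> bool" where
  "Krull_Schmidt T \<longleftrightarrow> (\<forall>X. \<exists>Xs. direct_sum T X Xs \<and> (\<forall>Y \<in> set Xs. local_End T Y))"


section \<open>Full subcategories\<close>

text \<open>A full subcategory is given by its set of objects.\<close>

definition summand_closed :: "('k, 'o, 'm::ab_group_add, 'z) tricat_scheme \<Rightarrow> 'o set \<Rightarrow> bool" where
  "summand_closed T U \<longleftrightarrow> (\<forall>X \<in> U. \<forall>A B. direct_sum T X [A, B] \<longrightarrow> A \<in> U)"

definition thick :: "('k, 'o, 'm::ab_group_add, 'z) tricat_scheme \<Rightarrow> 'o set \<Rightarrow> bool" where
  "thick T U \<longleftrightarrow> U \<noteq> {} \<and> (\<forall>X \<in> U. susO T X \<in> U \<and> desO T X \<in> U) \<and>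
     (\<forall>X Y Z f g h. (X, Y, Z, f, g, h) \<in> tri T \<longrightarrow> X \<in> U \<longrightarrow> Y \<in> U \<longrightarrow> Z \<in> U) \<and>
     summand_closed T U"

definition thick_closure :: "('k, 'o, 'm::ab_group_add, 'z) tricat_scheme \<Rightarrow> 'o set \<Rightarrow> 'o set" where
  "thick_closure T S = \<Inter> {U. thick T U \<and> S \<subseteq> U}"

definition right_perp :: "('k, 'o, 'm::ab_group_add, 'z) tricat_scheme \<Rightarrow> 'o set \<Rightarrow> 'o set" where
  "right_perp T U = {Y. \<forall>X \<in> U. Hom T X Y = {0}}"

definition left_perp :: "('k, 'o, 'm::ab_group_add, 'z) tricat_scheme \<Rightarrow> 'o set \<Rightarrow> 'o set" where
  "left_perp T U = {Y. \<forall>X \<in> U. Hom T Y X = {0}}"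

definition star :: "('k, 'o, 'm::ab_group_add, 'z) tricat_scheme \<Rightarrow> 'o set \<Rightarrow> 'o set \<Rightarrow> 'o set" where
  "star T A B = {E. \<exists>X \<in> A. \<exists>Y \<in> B. \<exists>f g h. (X, E, Y, f, g, h) \<in> tri T}"

definition torsion_pair ::
    "('k, 'o, 'm::ab_group_add, 'z) tricat_scheme \<Rightarrow> 'o set \<Rightarrow> 'o set \<Rightarrow> bool" where
  "torsion_pair T A B \<longleftrightarrow> summand_closed T A \<and> summand_closed T B \<and>
     (\<forall>X \<in> A. \<forall>Y \<in> B. Hom T X Y = {0}) \<and> star T A B = UNIV"

definition co_t_structure ::
    "('k, 'o, 'm::ab_group_add, 'z) tricat_scheme \<Rightarrow> 'o set \<Rightarrow> 'o set \<Rightarrow> bool" where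
  "co_t_structure T A B \<longleftrightarrow> torsion_pair T A B \<and> shiftO T (- 1) ` A \<subseteq> A"

definition shifts_nonneg :: "('k, 'o, 'm, 'z) tricat_scheme \<Rightarrow> 'o set \<Rightarrow> 'o set" where
  "shifts_nonneg T S = {shiftO T m X | m X. 0 \<le> m \<and> X \<in> S}"

definition shifts_neg :: "('k, 'o, 'm, 'z) tricat_scheme \<Rightarrow> 'o set \<Rightarrow> 'o set" where
  "shifts_neg T S = {shiftO T m X | m X. m < 0 \<and> X \<in> S}"


section \<open>Calabi--Yau triples\<close>

definition simple_minded :: "('k::field, 'o, 'm::ab_group_add, 'z) tricat_scheme \<Rightarrow> 'o set \<Rightarrow> bool" where
  "simple_minded T S \<longleftrightarrow>
     (\<forall>X \<in> S. \<forall>Y \<in> S. \<forall>m < 0. Hom T X (shiftO T m Y) = {0}) \<and>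
     (\<forall>X \<in> S. \<forall>Y \<in> S. vector_space.dim (scl T) (Hom T X Y) = (if X = Y then 1 else 0)) \<and>
     thick_closure T S = UNIV"

text \<open>The \<open>k\<close>-dual of a Hom-space; a functional is \<open>undefined\<close> outside that space.\<close>

definition dual_Hom ::
    "('k::field, 'o, 'm::ab_group_add, 'z) tricat_scheme \<Rightarrow> 'o \<Rightarrow> 'o \<Rightarrow> ('m \<Rightarrow> 'k) set" where
  "dual_Hom T X Y = {\<xi> \<in> extensional (Hom T X Y).
     (\<forall>f \<in> Hom T X Y. \<forall>g \<in> Hom T X Y. \<xi> (f + g) = \<xi> f + \<xi> g) \<and>
     (\<forall>c. \<forall>f \<in> Hom T X Y. \<xi> (scl T c f) = c * \<xi> f)}"

text \<open>
  A linear isomorphism from the dual of \<open>Hom X Y\<close> to \<open>Hom Y (F X)\<close>, natural in \<open>X \<in> U\<close>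
  (covariantly) and in \<open>Y\<close> (contravariantly), where \<open>F\<close> is the functor \<open>(FO, FM)\<close>.
\<close>

definition relative_Serre ::
    "('k::field, 'o, 'm::ab_group_add, 'z) tricat_scheme \<Rightarrow> 'o set \<Rightarrow> ('o \<Rightarrow> 'o) \<Rightarrow> ('m \<Rightarrow> 'm) \<Rightarrow> bool" where
  "relative_Serre T U FO FM \<longleftrightarrow> (\<exists>\<phi> :: 'o \<Rightarrow> 'o \<Rightarrow> ('m \<Rightarrow> 'k) \<Rightarrow> 'm.
     (\<forall>X \<in> U. \<forall>Y. bij_betw (\<phi> X Y) (dual_Hom T X Y) (Hom T Y (FO X))) \<and>
     (\<forall>X \<in> U. \<forall>Y. \<forall>\<xi> \<in> dual_Hom T X Y. \<forall>\<eta> \<in> dual_Hom T X Y.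
        \<phi> X Y (\<lambda>f \<in> Hom T X Y. \<xi> f + \<eta> f) = \<phi> X Y \<xi> + \<phi> X Y \<eta>) \<and>
     (\<forall>X \<in> U. \<forall>Y c. \<forall>\<xi> \<in> dual_Hom T X Y.
        \<phi> X Y (\<lambda>f \<in> Hom T X Y. c * \<xi> f) = scl T c (\<phi> X Y \<xi>)) \<and>
     (\<forall>X \<in> U. \<forall>X' \<in> U. \<forall>Y. \<forall>a \<in> Hom T X X'. \<forall>\<xi> \<in> dual_Hom T X Y.
        \<phi> X' Y (\<lambda>f \<in> Hom T X' Y. \<xi> (f \<cdot>\<^bsub>T\<^esub> a)) = FM a \<cdot>\<^bsub>T\<^esub> \<phi> X Y \<xi>) \<and>
     (\<forall>X \<in> U. \<forall>Y Y'. \<forall>b \<in> Hom T Y' Y. \<forall>\<xi> \<in> dual_Hom T X Y.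
        \<phi> X Y' (\<lambda>f \<in> Hom T X Y'. \<xi> (b \<cdot>\<^bsub>T\<^esub> f)) = \<phi> X Y \<xi> \<cdot>\<^bsub>T\<^esub> b))"

text \<open>\<open>cy_triple T P S d\<close>: \<open>(T, P, S)\<close> is a \<open>(-d)\<close>-Calabi--Yau triple.\<close>

locale cy_triple = triangulated_category T
  for T :: "('k::field, 'o, 'm::ab_group_add, 'z) tricat_scheme" (structure) +
  fixes P S :: "'o set" and d :: nat
  assumes RS0_Hom_finite: "Hom_finite T"
    and RS0_Krull_Schmidt: "Krull_Schmidt T"
    and RS0_thick: "thick T P"
    and RS1: "relative_Serre T P (shiftO T (- int d)) (shiftM T (- int d))"
    and RS2_simple_minded: "simple_minded T S"
    and RS2_left: "co_t_structure T (left_perp T (shifts_nonneg T S)) (left_perp T (shifts_neg T S))"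
    and RS2_right: "co_t_structure T (right_perp T (shifts_nonneg T S)) (right_perp T (shifts_neg T S))"
    and RS2_left_perfect: "left_perp T (shifts_nonneg T S) \<subseteq> P"
    and RS2_right_perfect: "right_perp T (shifts_neg T S) \<subseteq> P"


section \<open>Hom-spaces of the Verdier quotient\<close>

text \<open>Morphisms with cone in \<open>U\<close>, which the Verdier quotient by \<open>U\<close> inverts.\<close>

definition cone_in ::
    "('k, 'o, 'm::ab_group_add, 'z) tricat_scheme \<Rightarrow> 'o set \<Rightarrow> 'o \<Rightarrow> 'o \<Rightarrow> 'm set" where
  "cone_in T U X Y = {s. \<exists>C \<in> U. \<exists>g h. (X, Y, C, s, g, h) \<in> tri T}"

text \<open>\<open>(Z, s, f)\<close> is the roof \<open>X \<leftarrow>\<^sup>s Z \<rightarrow>\<^sup>f Y\<close>, representing \<open>f s\<^sup>-\<^sup>1\<close>.\<close>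

definition roofs ::
    "('k, 'o, 'm::ab_group_add, 'z) tricat_scheme \<Rightarrow> 'o set \<Rightarrow> 'o \<Rightarrow> 'o \<Rightarrow> ('o \<times> 'm \<times> 'm) set" where
  "roofs T U X Y = {(Z, s, f). s \<in> cone_in T U Z X \<and> f \<in> Hom T Z Y}"

text \<open>Two roofs are equivalent if a third one dominates both.\<close>

definition roof_rel ::
    "('k, 'o, 'm::ab_group_add, 'z) tricat_scheme \<Rightarrow> 'o set \<Rightarrow> 'o \<Rightarrow> 'o \<Rightarrow>
     (('o \<times> 'm \<times> 'm) \<times> ('o \<times> 'm \<times> 'm)) set" where
  "roof_rel T U X Y = {((Z, s, f), (Z', s', f')).
     (Z, s, f) \<in> roofs T U X Y \<and> (Z', s', f') \<in> roofs T U X Y \<and>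
     (\<exists>W. \<exists>u \<in> Hom T W Z. \<exists>v \<in> Hom T W Z'.
        s \<cdot>\<^bsub>T\<^esub> u = s' \<cdot>\<^bsub>T\<^esub> v \<and> f \<cdot>\<^bsub>T\<^esub> u = f' \<cdot>\<^bsub>T\<^esub> v \<and> s \<cdot>\<^bsub>T\<^esub> u \<in> cone_in T U W X)}"

definition Verdier_Hom ::
    "('k, 'o, 'm::ab_group_add, 'z) tricat_scheme \<Rightarrow> 'o set \<Rightarrow> 'o \<Rightarrow> 'o \<Rightarrow> ('o \<times> 'm \<times> 'm) set set" where
  "Verdier_Hom T U X Y = roofs T U X Y // roof_rel T U X Y"

text \<open>The quotient functor on morphisms; the zero of \<open>Verdier_Hom T U X Y\<close> is the image of \<open>0\<close>.\<close>

definition Verdier_quotient_map ::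
    "('k, 'o, 'm::ab_group_add, 'z) tricat_scheme \<Rightarrow> 'o set \<Rightarrow> 'o \<Rightarrow> 'o \<Rightarrow> 'm \<Rightarrow> ('o \<times> 'm \<times> 'm) set" where
  "Verdier_quotient_map T U X Y f = roof_rel T U X Y `` {(X, idt T X, f)}"

definition Verdier_zero ::
    "('k, 'o, 'm::ab_group_add, 'z) tricat_scheme \<Rightarrow> 'o set \<Rightarrow> 'o \<Rightarrow> 'o \<Rightarrow> ('o \<times> 'm \<times> 'm) set" where
  "Verdier_zero T U X Y = Verdier_quotient_map T U X Y 0"

end

theory Submission
  imports Defs
begin

text \<open>
  The vanishing holds because, in the quotient, every morphism out of \<open>V = \<Sigma>\<^sup>j Y\<close> can be represented
  by a roof whose apex admits no nonzero morphism to \<open>X\<close> in \<open>T\<close> at all.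

  Given \<open>s : Z \<rightarrow> V\<close> with cone \<open>C \<in> P\<close>, decompose \<open>\<Sigma>\<^sup>-\<^sup>1 C\<close> by the left co-t-structure, which after
  suspension gives a triangle \<open>\<Sigma>A \<rightarrow> C \<rightarrow> \<Sigma>B\<close> with \<open>A \<in> \<^sup>\<bottom>(\<Sigma>\<^bsup>\<ge>0\<^esup> S)\<close> and
  \<open>B \<in> \<^sup>\<bottom>(\<Sigma>\<^bsup><0\<^esup> S)\<close>. Both \<open>A\<close> and \<open>B\<close> lie in \<open>P\<close>, so relative Serre duality applies to \<open>B\<close>:
  \<open>Hom(\<Sigma>\<^sup>j Y, \<Sigma>B)\<close> is dual to \<open>Hom(B, \<Sigma>\<^bsup>j-d-1\<^esup> Y)\<close>, which is zero because \<open>j \<le> d\<close>. This is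
  where the one-step shift of the decomposition matters: without it the case \<open>j = d\<close> is lost.
  Hence \<open>V \<rightarrow> C\<close> factors through \<open>\<Sigma>A\<close>, and the fibre \<open>Z'\<close> of \<open>V \<rightarrow> \<Sigma>A\<close> maps to \<open>Z\<close> over \<open>V\<close>. In
  the exact sequence
  \<open>Hom(\<Sigma>\<^sup>j Y, X) \<rightarrow> Hom(Z', X) \<rightarrow> Hom(A, X)\<close> the left term is zero since \<open>S\<close> is simple-minded
  and \<open>j \<ge> 1\<close>, the right one by the choice of \<open>A\<close>. So \<open>Hom(Z', X) = 0\<close>
  (lemma \<open>refinement_with_no_map_to_simple\<close>).

  Any two roofs have a common refinement of their left legs (lemma \<open>cone_in_common_refinement\<close>);
  refining once more to such a \<open>Z'\<close> kills both right legs, so any two roofs are equivalent and the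
  quotient Hom-space is a point (lemma \<open>Verdier_Hom_trivial\<close>).
\<close>

section \<open>Linear categories and quasi-inverse functors\<close>

context linear_category
begin

lemma zero_in_Hom [simp, intro]: "0 \<in> Hom T X Y"
  using Hom_subspace subspace_0 by blast

lemma uminus_in_Hom: "f \<in> Hom T X Y \<Longrightarrow> - f \<in> Hom T X Y"
  using Hom_subspace subspace_neg by blast

lemma cmp_zero_left [simp]: "f \<in> Hom T X Y \<Longrightarrow> 0 \<cdot> f = 0"
  using cmp_add_left[of f X Y 0 Y 0] by simp

lemma cmp_zero_right [simp]: "g \<in> Hom T Y Z \<Longrightarrow> g \<cdot> 0 = 0"
  using cmp_add_right[of 0 Y Y 0 g Z] by simp

lemma cmp_uminus_left:
  assumes "f \<in> Hom T X Y" and "g \<in> Hom T Y Z"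
  shows "(- g) \<cdot> f = - (g \<cdot> f)"
  using cmp_add_left[OF assms(1,2) uminus_in_Hom[OF assms(2)]] assms
  by (simp add: eq_neg_iff_add_eq_0 add.commute)

lemma cmp_uminus_right:
  assumes "f \<in> Hom T X Y" and "g \<in> Hom T Y Z"
  shows "g \<cdot> (- f) = - (g \<cdot> f)"
  using cmp_add_right[OF assms(1) uminus_in_Hom[OF assms(1)] assms(2)] assms
  by (simp add: eq_neg_iff_add_eq_0 add.commute)

lemma zero_objectI:
  assumes "idt T O' = 0"
  shows "zero_object T O'"
  unfolding zero_object_def
proof (intro allI conjI)
  fix X
  show "Hom T O' X = {0}"
    using cmp_idt_right[of _ O' X] cmp_zero_right[of _ O' X] assms by force
  show "Hom T X O' = {0}"
    using cmp_idt_left[of _ X O'] cmp_zero_left[of _ X O'] assms by force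
qed

lemma iso_mor_idt: "iso_mor T X X (idt T X)"
  unfolding iso_mor_def using idt_in_Hom cmp_idt_left by blast

lemma functor_in_Hom:
  "linear_endofunctor T FO FM \<Longrightarrow> f \<in> Hom T X Y \<Longrightarrow> FM f \<in> Hom T (FO X) (FO Y)"
  unfolding linear_endofunctor_def by blast

lemma functor_cmp:
  "linear_endofunctor T FO FM \<Longrightarrow> f \<in> Hom T X Y \<Longrightarrow> g \<in> Hom T Y Z \<Longrightarrow> FM (g \<cdot> f) = FM g \<cdot> FM f"
  unfolding linear_endofunctor_def by blast

lemma functor_zero:
  assumes "linear_endofunctor T FO FM"
  shows "FM 0 = 0"
proof -
  have "FM (0 + 0) = FM 0 + FM 0"
    using assms zero_in_Hom unfolding linear_endofunctor_def by blast
  then show ?thesis by simp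
qed

lemma functor_uminus:
  assumes "linear_endofunctor T FO FM" and "f \<in> Hom T X Y"
  shows "FM (- f) = - FM f"
proof -
  have "FM (f + - f) = FM f + FM (- f)"
    using assms uminus_in_Hom unfolding linear_endofunctor_def by blast
  then show ?thesis using functor_zero[OF assms(1)] by (simp add: eq_neg_iff_add_eq_0 add.commute)
qed

lemma functor_faithful:
  assumes F: "linear_endofunctor T FO FM" and G: "linear_endofunctor T GO GM"
    and GF: "naturally_isomorphic T (GO \<circ> FO) (GM \<circ> FM) id id"
    and f: "f \<in> Hom T X Y" and f': "f' \<in> Hom T X Y" and eq: "FM f = FM f'"
  shows "f = f'"
proof -
  obtain \<alpha> where iso: "\<And>X. iso_mor T (GO (FO X)) X (\<alpha> X)"
    and nat: "\<And>X Y f. f \<in> Hom T X Y \<Longrightarrow> \<alpha> Y \<cdot> GM (FM f) = f \<cdot> \<alpha> X"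
    using GF unfolding naturally_isomorphic_def o_apply id_apply by blast
  obtain \<beta> where \<alpha>: "\<alpha> X \<in> Hom T (GO (FO X)) X" and \<beta>: "\<beta> \<in> Hom T X (GO (FO X))"
    and inv: "\<alpha> X \<cdot> \<beta> = idt T X"
    using iso[of X] unfolding iso_mor_def by blast
  have retract: "h = (\<alpha> Y \<cdot> GM (FM h)) \<cdot> \<beta>" if h: "h \<in> Hom T X Y" for h
    using nat[OF h] cmp_assoc[OF \<beta> \<alpha> h] inv cmp_idt_right[OF h] by simp
  show ?thesis using retract[OF f] retract[OF f'] eq by simp
qed

text \<open>
  The preimage of \<open>g\<close> is \<open>GM g\<close> transported along the isomorphisms from \<open>GO \<circ> FO\<close> to the identity.
  It is mapped to \<open>g\<close> because \<open>G\<close> sends both to the same morphism and is itself faithful.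
\<close>

lemma functor_full:
  assumes F: "linear_endofunctor T FO FM" and G: "linear_endofunctor T GO GM"
    and GF: "naturally_isomorphic T (GO \<circ> FO) (GM \<circ> FM) id id"
    and FG: "naturally_isomorphic T (FO \<circ> GO) (FM \<circ> GM) id id"
    and g: "g \<in> Hom T (FO X) (FO Y)"
  obtains f where "f \<in> Hom T X Y" and "FM f = g"
proof -
  obtain \<alpha> where iso: "\<And>X. iso_mor T (GO (FO X)) X (\<alpha> X)"
    and nat: "\<And>X Y f. f \<in> Hom T X Y \<Longrightarrow> \<alpha> Y \<cdot> GM (FM f) = f \<cdot> \<alpha> X"
    using GF unfolding naturally_isomorphic_def o_apply id_apply by blast
  obtain \<beta> where \<alpha>X: "\<alpha> X \<in> Hom T (GO (FO X)) X" and \<beta>: "\<beta> \<in> Hom T X (GO (FO X))"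
    and inv: "\<beta> \<cdot> \<alpha> X = idt T (GO (FO X))"
    using iso[of X] unfolding iso_mor_def by blast
  obtain \<gamma> where \<alpha>Y: "\<alpha> Y \<in> Hom T (GO (FO Y)) Y" and \<gamma>: "\<gamma> \<in> Hom T Y (GO (FO Y))"
    and invY: "\<gamma> \<cdot> \<alpha> Y = idt T (GO (FO Y))"
    using iso[of Y] unfolding iso_mor_def by blast
  have Gg: "GM g \<in> Hom T (GO (FO X)) (GO (FO Y))" using functor_in_Hom[OF G g] .
  define f where "f = (\<alpha> Y \<cdot> GM g) \<cdot> \<beta>"
  have \<alpha>Gg: "\<alpha> Y \<cdot> GM g \<in> Hom T (GO (FO X)) Y" using cmp_in_Hom[OF Gg \<alpha>Y] .
  have f: "f \<in> Hom T X Y" unfolding f_def using cmp_in_Hom[OF \<beta> \<alpha>Gg] .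
  have Ff: "FM f \<in> Hom T (FO X) (FO Y)" using functor_in_Hom[OF F f] .
  have GFf: "GM (FM f) \<in> Hom T (GO (FO X)) (GO (FO Y))" using functor_in_Hom[OF G Ff] .
  have "f \<cdot> \<alpha> X = \<alpha> Y \<cdot> GM g"
    unfolding f_def
    using cmp_assoc[OF \<alpha>X \<beta> \<alpha>Gg] inv cmp_idt_right[OF \<alpha>Gg] by simp
  then have eq: "\<alpha> Y \<cdot> GM (FM f) = \<alpha> Y \<cdot> GM g" using nat[OF f] by simp
  have "GM (FM f) = (\<gamma> \<cdot> \<alpha> Y) \<cdot> GM (FM f)" using invY cmp_idt_left[OF GFf] by simp
  also have "\<dots> = (\<gamma> \<cdot> \<alpha> Y) \<cdot> GM g"
    using cmp_assoc[OF GFf \<alpha>Y \<gamma>] cmp_assoc[OF Gg \<alpha>Y \<gamma>] eq by simp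
  also have "\<dots> = GM g" using invY cmp_idt_left[OF Gg] by simp
  finally have "FM f = g" using functor_faithful[OF G F FG Ff g] by blast
  with f show thesis by (rule that)
qed

lemma functor_Hom_zero_iff:
  assumes F: "linear_endofunctor T FO FM" and G: "linear_endofunctor T GO GM"
    and GF: "naturally_isomorphic T (GO \<circ> FO) (GM \<circ> FM) id id"
    and FG: "naturally_isomorphic T (FO \<circ> GO) (FM \<circ> GM) id id"
  shows "Hom T (FO X) (FO Y) = {0} \<longleftrightarrow> Hom T X Y = {0}"
proof
  assume zero: "Hom T (FO X) (FO Y) = {0}"
  have "f = 0" if f: "f \<in> Hom T X Y" for f
  proof -
    have "FM f = FM 0" using functor_in_Hom[OF F f] zero functor_zero[OF F] by simp
    then show ?thesis using functor_faithful[OF F G GF f] by blast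
  qed
  then show "Hom T X Y = {0}" by auto
next
  assume zero: "Hom T X Y = {0}"
  have "g = 0" if "g \<in> Hom T (FO X) (FO Y)" for g
    using functor_full[OF F G GF FG that] zero functor_zero[OF F] by (metis singletonD)
  then show "Hom T (FO X) (FO Y) = {0}" by auto
qed

lemma iso_Hom_zero:
  assumes "iso_mor T X X' a" and zero: "Hom T X Y = {0}"
  shows "Hom T X' Y = {0}"
proof -
  obtain b where a: "a \<in> Hom T X X'" and b: "b \<in> Hom T X' X" and inv: "a \<cdot> b = idt T X'"
    using assms(1) unfolding iso_mor_def by blast
  have "f = 0" if f: "f \<in> Hom T X' Y" for f
  proof -
    have "f \<cdot> a = 0" using cmp_in_Hom[OF a f] zero by simp
    then show ?thesis
      using cmp_assoc[OF b a f] inv cmp_idt_right[OF f] cmp_zero_left[OF b] by simp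
  qed
  then show ?thesis by auto
qed

lemma iso_mor_inverse:
  assumes "iso_mor T X Y f"
  obtains g where "iso_mor T Y X g" and "g \<cdot> f = idt T X" and "f \<cdot> g = idt T Y"
  using assms unfolding iso_mor_def by metis

end


section \<open>Suspension and exactness in triangulated categories\<close>

context triangulated_category
begin

lemma sus_in_Hom: "f \<in> Hom T X Y \<Longrightarrow> susM T f \<in> Hom T (susO T X) (susO T Y)"
  using functor_in_Hom[OF sus_functor] .

lemma sus_zero [simp]: "susM T 0 = 0"
  using functor_zero[OF sus_functor] .

lemma sus_cmp: "f \<in> Hom T X Y \<Longrightarrow> g \<in> Hom T Y Z \<Longrightarrow> susM T (g \<cdot> f) = susM T g \<cdot> susM T f"
  using functor_cmp[OF sus_functor] .

lemma sus_uminus: "f \<in> Hom T X Y \<Longrightarrow> susM T (- f) = - susM T f"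
  using functor_uminus[OF sus_functor] .

lemma sus_idt: "susM T (idt T X) = idt T (susO T X)"
  using sus_functor unfolding linear_endofunctor_def by blast

lemmas sus_faithful = functor_faithful[OF sus_functor des_functor des_sus]
lemmas sus_full = functor_full[OF sus_functor des_functor des_sus sus_des]
lemmas sus_Hom_zero_iff = functor_Hom_zero_iff[OF sus_functor des_functor des_sus sus_des]
lemmas des_Hom_zero_iff = functor_Hom_zero_iff[OF des_functor sus_functor sus_des des_sus]

lemma sus_des_iso:
  obtains a where "iso_mor T (susO T (desO T X)) X a"
  using sus_des unfolding naturally_isomorphic_def by auto

lemma des_sus_iso:
  obtains a where "iso_mor T (desO T (susO T X)) X a"
  using des_sus unfolding naturally_isomorphic_def by auto

lemma sus_des_adjoint_Hom_zero: "Hom T (susO T X) Y = {0} \<longleftrightarrow> Hom T X (desO T Y) = {0}"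
proof -
  obtain a where a: "iso_mor T (desO T (susO T X)) X a" by (rule des_sus_iso)
  obtain b where b: "iso_mor T X (desO T (susO T X)) b" using iso_mor_inverse[OF a] .
  have "Hom T (susO T X) Y = {0} \<longleftrightarrow> Hom T (desO T (susO T X)) (desO T Y) = {0}"
    by (simp add: des_Hom_zero_iff)
  also have "\<dots> \<longleftrightarrow> Hom T X (desO T Y) = {0}"
    using iso_Hom_zero[OF a] iso_Hom_zero[OF b] by blast
  finally show ?thesis .
qed

lemma sus_pow_adjoint_Hom_zero:
  "Hom T ((susO T ^^ n) X) Y = {0} \<longleftrightarrow> Hom T X ((desO T ^^ n) Y) = {0}"
proof (induction n arbitrary: Y)
  case (Suc n)
  show ?case
    using Suc[of "desO T Y"] by (simp add: sus_des_adjoint_Hom_zero funpow_swap1[of "desO T"])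
qed simp

lemma sus_pow_Hom_zero_iff:
  "Hom T ((susO T ^^ n) X) ((susO T ^^ n) Y) = {0} \<longleftrightarrow> Hom T X Y = {0}"
  by (induction n) (simp_all add: sus_Hom_zero_iff)

lemma des_pow_Hom_zero_iff:
  "Hom T ((desO T ^^ n) X) ((desO T ^^ n) Y) = {0} \<longleftrightarrow> Hom T X Y = {0}"
  by (induction n) (simp_all add: des_Hom_zero_iff)

lemma zero_object_exists: "\<exists>Z. zero_object T Z"
proof -
  obtain Z where "direct_sum T Z []" using direct_sum_exists by blast
  then have "idt T Z = 0" unfolding direct_sum_def by auto
  then show ?thesis using zero_objectI by blast
qed

lemma zero_object_sus:
  assumes "zero_object T Z"
  shows "zero_object T (susO T Z)"
proof (rule zero_objectI)
  have "idt T Z = 0" using assms idt_in_Hom unfolding zero_object_def by blast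
  then show "idt T (susO T Z) = 0" using sus_idt[of Z] by simp
qed

lemma tri_sus:
  assumes "(X, Y, Z, f, g, h) \<in> tri T"
  shows "(susO T X, susO T Y, susO T Z, - susM T f, - susM T g, - susM T h) \<in> tri T"
proof -
  have f: "f \<in> Hom T X Y" and g: "g \<in> Hom T Y Z" and h: "h \<in> Hom T Z (susO T X)"
    using tri_in_Hom[OF assms] by auto
  have f': "- susM T f \<in> Hom T (susO T X) (susO T Y)"
    and g': "- susM T g \<in> Hom T (susO T Y) (susO T Z)"
    using f g by (simp_all add: uminus_in_Hom sus_in_Hom)
  show ?thesis
    using assms tri_rotate[OF f g h] tri_rotate[OF g h f'] tri_rotate[OF h f' g'] by blast
qed

lemma tri_cmp_zero:
  assumes t: "(X, Y, Z, f, g, h) \<in> tri T"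
  shows "g \<cdot> f = 0"
proof -
  have f: "f \<in> Hom T X Y" using tri_in_Hom[OF t] by blast
  obtain O' where O': "zero_object T O'" using zero_object_exists by blast
  obtain c where "c \<in> Hom T O' Z" and "c \<cdot> 0 = g \<cdot> f"
    using tri_morphism[OF tri_idt[OF O'] t idt_in_Hom f] by blast
  then show ?thesis by simp
qed

text \<open>Exactness of \<open>Hom(W, X) \<rightarrow> Hom(W, Y) \<rightarrow> Hom(W, Z)\<close>: compare with the triangle on \<open>idt T W\<close>.\<close>

lemma tri_lift:
  assumes t: "(X, Y, Z, f, g, h) \<in> tri T" and u: "u \<in> Hom T W Y" and gu: "g \<cdot> u = 0"
  obtains v where "v \<in> Hom T W X" and "f \<cdot> v = u"
proof -
  have f: "f \<in> Hom T X Y" and g: "g \<in> Hom T Y Z" and h: "h \<in> Hom T Z (susO T X)"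
    using tri_in_Hom[OF t] by auto
  obtain O' where O': "zero_object T O'" using zero_object_exists by blast
  have 1: "(W, O', susO T W, 0, 0, - idt T (susO T W)) \<in> tri T"
    using tri_idt[OF O', of W] tri_rotate[of "idt T W" W W 0 O' 0] idt_in_Hom sus_idt by simp
  have 2: "(Y, Z, susO T X, g, h, - susM T f) \<in> tri T" using t tri_rotate[OF f g h] by blast
  obtain c where c: "c \<in> Hom T (susO T W) (susO T X)"
    and eq: "susM T u \<cdot> (- idt T (susO T W)) = (- susM T f) \<cdot> c"
    using tri_morphism[OF 1 2 u, of 0] u gu by auto
  obtain v where v: "v \<in> Hom T W X" and cv: "susM T v = c" using sus_full[OF c] .
  have su: "susM T u \<in> Hom T (susO T W) (susO T Y)" using sus_in_Hom[OF u] .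
  have "susM T u = susM T f \<cdot> c"
    using eq cmp_uminus_right[OF idt_in_Hom su] cmp_uminus_left[OF c sus_in_Hom[OF f]]
      cmp_idt_right[OF su] by simp
  then have "susM T (f \<cdot> v) = susM T u" using sus_cmp[OF v f] cv by simp
  then have "f \<cdot> v = u" using sus_faithful[OF cmp_in_Hom[OF v f] u] by blast
  with v show thesis by (rule that)
qed

lemma tri_zero_idt:
  assumes O': "zero_object T O'"
  shows "(O', W, W, 0, idt T W, 0) \<in> tri T"
  using tri_idt[OF zero_object_sus[OF O'], of W] tri_rotate[of 0 O' W "idt T W" W 0] idt_in_Hom
  by simp

text \<open>Exactness of \<open>Hom(Z, W) \<rightarrow> Hom(Y, W) \<rightarrow> Hom(X, W)\<close>: compare with the triangle \<open>0 \<rightarrow> W = W\<close>.\<close>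

lemma tri_extend:
  assumes t: "(X, Y, Z, f, g, h) \<in> tri T" and u: "u \<in> Hom T Y W" and uf: "u \<cdot> f = 0"
  obtains v where "v \<in> Hom T Z W" and "v \<cdot> g = u"
proof -
  obtain O' where O': "zero_object T O'" using zero_object_exists by blast
  obtain c where "c \<in> Hom T Z W" and "c \<cdot> g = idt T W \<cdot> u"
    using tri_morphism[OF t tri_zero_idt[OF O', of W] zero_in_Hom u] uf by auto
  then show thesis using that cmp_idt_left[OF u] by simp
qed

lemma tri_iso_third:
  assumes t: "(X, Y, Z, f, g, h) \<in> tri T" and c: "iso_mor T Z Z' c"
  obtains h' where "(X, Y, Z', f, c \<cdot> g, h') \<in> tri T"
proof -
  have f: "f \<in> Hom T X Y" and g: "g \<in> Hom T Y Z" and h: "h \<in> Hom T Z (susO T X)"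
    using tri_in_Hom[OF t] by auto
  obtain e where e: "iso_mor T Z' Z e" and ec: "e \<cdot> c = idt T Z"
    using iso_mor_inverse[OF c] .
  have cH: "c \<in> Hom T Z Z'" and eH: "e \<in> Hom T Z' Z" using c e unfolding iso_mor_def by auto
  have "susM T (idt T X) \<cdot> h = (h \<cdot> e) \<cdot> c"
    using cmp_assoc[OF cH eH h] ec cmp_idt_right[OF h] cmp_idt_left[OF h] sus_idt by simp
  then have "(X, Y, Z', f, c \<cdot> g, h \<cdot> e) \<in> tri T"
    using tri_iso[OF t f cmp_in_Hom[OF g cH] cmp_in_Hom[OF eH h] iso_mor_idt iso_mor_idt c]
      cmp_idt_left[OF f] cmp_idt_right[OF f] cmp_idt_right[OF cmp_in_Hom[OF g cH]] by simp
  then show thesis by (rule that)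
qed

text \<open>
  The fibre is the desuspended cone. The sign in \<open>- s\<close> cancels the one that rotation introduces.
\<close>

lemma tri_fibre:
  assumes v: "v \<in> Hom T Y C"
  obtains Z s u where "(Z, Y, C, s, v, u) \<in> tri T"
proof -
  obtain W p q where t: "(Y, C, W, v, p, q) \<in> tri T" using tri_cone[OF v] by blast
  obtain b where "iso_mor T (susO T (desO T W)) W b" by (rule sus_des_iso)
  then obtain c where c: "iso_mor T W (susO T (desO T W)) c" by (rule iso_mor_inverse)
  obtain q' where t': "(Y, C, susO T (desO T W), v, c \<cdot> p, q') \<in> tri T"
    using tri_iso_third[OF t c] .
  have cp: "c \<cdot> p \<in> Hom T C (susO T (desO T W))"
    and q': "q' \<in> Hom T (susO T (desO T W)) (susO T Y)"
    using tri_in_Hom[OF t'] by auto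
  obtain s where s: "s \<in> Hom T (desO T W) Y" and "susM T s = q'" using sus_full[OF q'] .
  then have "- susM T (- s) = q'" using sus_uminus[OF s] by simp
  then have "(desO T W, Y, C, - s, v, c \<cdot> p) \<in> tri T"
    using tri_rotate[OF uminus_in_Hom[OF s] v cp] t' by simp
  then show thesis by (rule that)
qed

end


section \<open>Thick subcategories and roofs\<close>

context triangulated_category
begin

lemma thick_third:
  "thick T U \<Longrightarrow> (X, Y, Z, f, g, h) \<in> tri T \<Longrightarrow> X \<in> U \<Longrightarrow> Y \<in> U \<Longrightarrow> Z \<in> U"
  unfolding thick_def by blast

lemma thick_sus: "thick T U \<Longrightarrow> X \<in> U \<Longrightarrow> susO T X \<in> U"
  and thick_des: "thick T U \<Longrightarrow> X \<in> U \<Longrightarrow> desO T X \<in> U"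
  unfolding thick_def by blast+

lemma thick_zero_object:
  assumes "thick T U" and "zero_object T Z"
  shows "Z \<in> U"
proof -
  obtain X where "X \<in> U" using assms(1) unfolding thick_def by blast
  then show ?thesis using thick_third[OF assms(1) tri_idt[OF assms(2)]] by blast
qed

lemma thick_iso:
  assumes U: "thick T U" and X: "X \<in> U" and c: "iso_mor T X Y c"
  shows "Y \<in> U"
proof -
  obtain O' where O': "zero_object T O'" using zero_object_exists by blast
  show ?thesis
    using tri_iso_third[OF tri_zero_idt[OF O'] c] thick_third[OF U] thick_zero_object[OF U O'] X
    by metis
qed

text \<open>
  Thickness speaks of the third vertex only. Rotating makes \<open>susO T Y\<close> the third vertex, and
  desuspending recovers \<open>Y\<close> up to isomorphism.
\<close>

lemma thick_middle:
  assumes U: "thick T U" and t: "(X, Y, Z, f, g, h) \<in> tri T" and X: "X \<in> U" and Z: "Z \<in> U"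
  shows "Y \<in> U"
proof -
  have f: "f \<in> Hom T X Y" and g: "g \<in> Hom T Y Z" and h: "h \<in> Hom T Z (susO T X)"
    using tri_in_Hom[OF t] by auto
  have "(Z, susO T X, susO T Y, h, - susM T f, - susM T g) \<in> tri T"
    using t tri_rotate[OF f g h] tri_rotate[OF g h uminus_in_Hom[OF sus_in_Hom[OF f]]] by blast
  then have "desO T (susO T Y) \<in> U"
    using thick_third[OF U _ Z thick_sus[OF U X]] thick_des[OF U] by blast
  then show ?thesis using thick_iso[OF U] des_sus_iso by metis
qed

lemma cone_in_idt:
  assumes "thick T U"
  shows "idt T X \<in> cone_in T U X X"
  using zero_object_exists thick_zero_object[OF assms] tri_idt unfolding cone_in_def by blast

text \<open>By the octahedral axiom the cone of \<open>g \<cdot> f\<close> is an extension of the cones of \<open>f\<close> and \<open>g\<close>.\<close>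

lemma cone_in_cmp:
  assumes U: "thick T U" and f: "f \<in> cone_in T U X Y" and g: "g \<in> cone_in T U Y Z"
  shows "g \<cdot> f \<in> cone_in T U X Z"
proof -
  obtain C p q where C: "C \<in> U" and tf: "(X, Y, C, f, p, q) \<in> tri T"
    using f unfolding cone_in_def by blast
  obtain D r s where D: "D \<in> U" and tg: "(Y, Z, D, g, r, s) \<in> tri T"
    using g unfolding cone_in_def by blast
  have "g \<cdot> f \<in> Hom T X Z" using tri_in_Hom[OF tf] tri_in_Hom[OF tg] cmp_in_Hom by blast
  then obtain E t u where te: "(X, Z, E, g \<cdot> f, t, u) \<in> tri T" using tri_cone by blast
  obtain a b where "(C, E, D, a, b, susM T p \<cdot> s) \<in> tri T"
    using tri_octahedron[OF tf tg te] by blast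
  then have "E \<in> U" using thick_middle[OF U _ C D] by blast
  then show ?thesis using te unfolding cone_in_def by blast
qed

text \<open>
  The Ore condition. If \<open>C\<close> is the cone of \<open>s'\<close>, the fibre of \<open>Z \<rightarrow> Y \<rightarrow> C\<close> maps to \<open>Z'\<close> over \<open>Y\<close>.
\<close>

lemma cone_in_common_refinement:
  assumes U: "thick T U" and s: "s \<in> cone_in T U Z Y" and s': "s' \<in> cone_in T U Z' Y"
  obtains W u v where "u \<in> Hom T W Z" and "v \<in> Hom T W Z'" and "s \<cdot> u = s' \<cdot> v"
    and "s \<cdot> u \<in> cone_in T U W Y"
proof -
  have sH: "s \<in> Hom T Z Y" using s tri_in_Hom unfolding cone_in_def by blast
  obtain C g h where C: "C \<in> U" and t': "(Z', Y, C, s', g, h) \<in> tri T"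
    using s' unfolding cone_in_def by blast
  have g: "g \<in> Hom T Y C" using tri_in_Hom[OF t'] by blast
  obtain W u w where t: "(W, Z, C, u, g \<cdot> s, w) \<in> tri T" using tri_fibre[OF cmp_in_Hom[OF sH g]] .
  have u: "u \<in> Hom T W Z" using tri_in_Hom[OF t] by blast
  have "u \<in> cone_in T U W Z" using t C unfolding cone_in_def by blast
  then have su: "s \<cdot> u \<in> cone_in T U W Y" using cone_in_cmp[OF U _ s] by blast
  have "g \<cdot> (s \<cdot> u) = 0" using tri_cmp_zero[OF t] cmp_assoc[OF u sH g] by simp
  then obtain v where "v \<in> Hom T W Z'" and "s' \<cdot> v = s \<cdot> u"
    using tri_lift[OF t' cmp_in_Hom[OF u sH]] by blast
  then show thesis using that u su by metis
qed

text \<open>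
  A common refinement of two roofs need not equalise their right legs. Refining it further to an
  apex without nonzero morphisms to \<open>X\<close> makes both of them \<open>0\<close>, so the roof relation is total.
\<close>

lemma Verdier_Hom_trivial:
  assumes U: "thick T U"
    and refine: "\<And>Z s. s \<in> cone_in T U Z V \<Longrightarrow>
      \<exists>Z'. \<exists>t \<in> Hom T Z' Z. s \<cdot> t \<in> cone_in T U Z' V \<and> Hom T Z' X = {0}"
  shows "Verdier_Hom T U V X = {Verdier_zero T U V X}"
proof -
  let ?R = "roofs T U V X"
  have "((Z, s, f), (Z', s', f')) \<in> roof_rel T U V X"
    if "(Z, s, f) \<in> ?R" and "(Z', s', f') \<in> ?R" for Z s f Z' s' f'
  proof -
    have s: "s \<in> cone_in T U Z V" and f: "f \<in> Hom T Z X"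
      and s': "s' \<in> cone_in T U Z' V" and f': "f' \<in> Hom T Z' X"
      using that unfolding roofs_def by auto
    have sH: "s \<in> Hom T Z V" and s'H: "s' \<in> Hom T Z' V"
      using s s' tri_in_Hom unfolding cone_in_def by blast+
    obtain W u v where u: "u \<in> Hom T W Z" and v: "v \<in> Hom T W Z'" and uv: "s \<cdot> u = s' \<cdot> v"
      and su: "s \<cdot> u \<in> cone_in T U W V"
      using cone_in_common_refinement[OF U s s'] .
    obtain W' t where t: "t \<in> Hom T W' W" and cone: "(s \<cdot> u) \<cdot> t \<in> cone_in T U W' V"
      and zero: "Hom T W' X = {0}"
      using refine[OF su] by blast
    have ut: "u \<cdot> t \<in> Hom T W' Z" and vt: "v \<cdot> t \<in> Hom T W' Z'"
      using cmp_in_Hom[OF t u] cmp_in_Hom[OF t v] .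
    have assoc: "s \<cdot> (u \<cdot> t) = (s \<cdot> u) \<cdot> t" "s' \<cdot> (v \<cdot> t) = (s \<cdot> u) \<cdot> t"
      using cmp_assoc[OF t u sH] cmp_assoc[OF t v s'H] uv by simp_all
    have dominate: "f \<cdot> (u \<cdot> t) = f' \<cdot> (v \<cdot> t)"
      using cmp_in_Hom[OF ut f] cmp_in_Hom[OF vt f'] zero by simp
    have "\<exists>W. \<exists>u \<in> Hom T W Z. \<exists>v \<in> Hom T W Z'.
        s \<cdot> u = s' \<cdot> v \<and> f \<cdot> u = f' \<cdot> v \<and> s \<cdot> u \<in> cone_in T U W V"
      using ut vt assoc cone dominate by (metis (no_types))
    then show ?thesis unfolding roof_rel_def using that by simp
  qed
  moreover have "roof_rel T U V X \<subseteq> ?R \<times> ?R" unfolding roof_rel_def by auto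
  ultimately have total: "roof_rel T U V X = ?R \<times> ?R" by auto
  have "(V, idt T V, 0) \<in> ?R" using cone_in_idt[OF U] unfolding roofs_def by simp
  then show ?thesis
    unfolding Verdier_Hom_def Verdier_zero_def Verdier_quotient_map_def quotient_def total by auto
qed

text \<open>The dual of the zero space has exactly one element, and the duality is a bijection.\<close>

lemma relative_Serre_Hom_zero:
  assumes serre: "relative_Serre T U FO FM" and X: "X \<in> U" and zero: "Hom T X Y = {0}"
  shows "Hom T Y (FO X) = {0}"
proof -
  obtain \<phi> where "\<forall>X \<in> U. \<forall>Y. bij_betw (\<phi> X Y) (dual_Hom T X Y) (Hom T Y (FO X))"
    using serre unfolding relative_Serre_def by (elim exE conjE) (erule that)
  then have bij: "bij_betw (\<phi> X Y) (dual_Hom T X Y) (Hom T Y (FO X))"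
    using X by blast
  have unique: "\<xi> = \<eta>" if dual: "\<xi> \<in> dual_Hom T X Y" "\<eta> \<in> dual_Hom T X Y" for \<xi> \<eta>
  proof (rule extensionalityI)
    show "\<xi> \<in> extensional (Hom T X Y)" "\<eta> \<in> extensional (Hom T X Y)"
      using that unfolding dual_Hom_def by auto
    have at_zero: "\<zeta> 0 = 0" if "\<zeta> \<in> dual_Hom T X Y" for \<zeta>
    proof -
      have "\<zeta> (scl T 0 0) = 0 * \<zeta> 0" using that zero_in_Hom unfolding dual_Hom_def by blast
      then show ?thesis by simp
    qed
    then show "\<xi> f = \<eta> f" if "f \<in> Hom T X Y" for f
      using that zero at_zero[OF dual(1)] at_zero[OF dual(2)] by simp
  qed
  have "f = 0" if f: "f \<in> Hom T Y (FO X)" for f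
  proof -
    obtain \<xi> where \<xi>: "\<xi> \<in> dual_Hom T X Y" and f_eq: "f = \<phi> X Y \<xi>"
      using f bij_betw_imp_surj_on[OF bij] by blast
    obtain \<eta> where \<eta>: "\<eta> \<in> dual_Hom T X Y" and zero_eq: "0 = \<phi> X Y \<eta>"
      using zero_in_Hom[of Y "FO X"] bij_betw_imp_surj_on[OF bij] by blast
    show ?thesis unfolding f_eq unique[OF \<xi> \<eta>] by (rule zero_eq[symmetric])
  qed
  then show ?thesis by auto
qed

end


section \<open>Calabi--Yau triples\<close>

lemma shiftO_int: "shiftO T (int n) = susO T ^^ n"
  by (simp add: shiftO_def)

lemma shiftO_minus_int: "shiftO T (- int n) = desO T ^^ n"
  by (cases "n = 0") (simp_all add: shiftO_def)

context cy_triple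
begin

lemma simple_Hom_positive_shift:
  assumes "X \<in> S" and "Y \<in> S" and "1 \<le> j"
  shows "Hom T ((susO T ^^ j) Y) X = {0}"
proof -
  have "Hom T Y (shiftO T (- int j) X) = {0}"
    using RS2_simple_minded assms unfolding simple_minded_def by simp
  then show ?thesis by (simp add: sus_pow_adjoint_Hom_zero shiftO_minus_int)
qed

text \<open>
  Serre duality turns \<open>Hom(\<Sigma>\<^sup>j Y, \<Sigma>B)\<close> into the dual of \<open>Hom(B, \<Sigma>\<^bsup>j-d-1\<^esup> Y)\<close>, whose shift is
  negative.
\<close>

lemma Hom_simple_shift_coaisle:
  assumes Y: "Y \<in> S" and j: "j \<le> d" and B: "B \<in> left_perp T (shifts_neg T S)" and P: "B \<in> P"
  shows "Hom T ((susO T ^^ j) Y) (susO T B) = {0}"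
proof -
  let ?n = "d + 1 - j"
  have "shiftO T (- int ?n) Y \<in> shifts_neg T S"
    unfolding shifts_neg_def using Y j by (intro CollectI exI[of _ "- int ?n"] exI[of _ Y]) simp
  then have "Hom T B ((desO T ^^ ?n) Y) = {0}"
    using B unfolding left_perp_def shiftO_minus_int by blast
  then have "Hom T ((susO T ^^ ?n) B) Y = {0}" by (simp only: sus_pow_adjoint_Hom_zero)
  then have "Hom T ((susO T ^^ (j + ?n)) B) ((susO T ^^ j) Y) = {0}"
    by (simp only: funpow_add o_apply sus_pow_Hom_zero_iff)
  moreover have "j + ?n = d + 1" using j by simp
  ultimately have "Hom T ((susO T ^^ d) (susO T B)) ((susO T ^^ j) Y) = {0}"
    by (simp only: Suc_eq_plus1[symmetric] funpow_Suc_right o_apply)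
  then have "Hom T (susO T B) ((desO T ^^ d) ((susO T ^^ j) Y)) = {0}"
    by (simp add: sus_pow_adjoint_Hom_zero)
  then have "Hom T ((desO T ^^ d) ((susO T ^^ j) Y)) (shiftO T (- int d) (susO T B)) = {0}"
    by (rule relative_Serre_Hom_zero[OF RS1 thick_sus[OF RS0_thick P]])
  then show ?thesis by (simp only: shiftO_minus_int des_pow_Hom_zero_iff)
qed

text \<open>
  The cone of \<open>s\<close> is replaced by \<open>\<Sigma>A\<close> with \<open>A \<in> \<^sup>\<bottom>(\<Sigma>\<^bsup>\<ge>0\<^esup> S)\<close>, and then \<open>Hom(Z', X)\<close> is squeezed
  between \<open>Hom(\<Sigma>\<^sup>j Y, X)\<close> and \<open>Hom(A, X)\<close>, both of which vanish.
\<close>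

lemma refinement_with_no_map_to_simple:
  assumes X: "X \<in> S" and Y: "Y \<in> S" and j: "1 \<le> j" "j \<le> d"
    and s: "s \<in> cone_in T P Z ((susO T ^^ j) Y)"
  shows "\<exists>Z'. \<exists>t \<in> Hom T Z' Z. s \<cdot> t \<in> cone_in T P Z' ((susO T ^^ j) Y) \<and> Hom T Z' X = {0}"
proof -
  define V where "V = (susO T ^^ j) Y"
  obtain C g h where C: "C \<in> P" and t: "(Z, V, C, s, g, h) \<in> tri T"
    using s unfolding cone_in_def V_def by blast
  \<comment> \<open>The co-t-structure is applied to \<open>\<Sigma>\<^sup>-\<^sup>1 C\<close>, which gives the shifted decomposition of \<open>C\<close>.\<close>
  obtain A B a b c where A: "A \<in> left_perp T (shifts_nonneg T S)"
    and B: "B \<in> left_perp T (shifts_neg T S)" and dec: "(A, desO T C, B, a, b, c) \<in> tri T"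
    using RS2_left unfolding co_t_structure_def torsion_pair_def star_def by blast
  have AP: "A \<in> P" using A RS2_left_perfect by blast
  then have BP: "B \<in> P" using thick_third[OF RS0_thick dec _ thick_des[OF RS0_thick C]] by blast
  obtain e where e: "iso_mor T (susO T (desO T C)) C e" by (rule sus_des_iso)
  obtain e' where e': "iso_mor T C (susO T (desO T C)) e'" and ee': "e \<cdot> e' = idt T C"
    using iso_mor_inverse[OF e] .
  have eH: "e \<in> Hom T (susO T (desO T C)) C" and e'H: "e' \<in> Hom T C (susO T (desO T C))"
    using e e' unfolding iso_mor_def by auto
  have g: "g \<in> Hom T V C" using tri_in_Hom[OF t] by blast
  have e'g: "e' \<cdot> g \<in> Hom T V (susO T (desO T C))" using cmp_in_Hom[OF g e'H] .
  note sdec = tri_sus[OF dec]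
  have sa: "- susM T a \<in> Hom T (susO T A) (susO T (desO T C))"
    and sb: "- susM T b \<in> Hom T (susO T (desO T C)) (susO T B)"
    using tri_in_Hom[OF sdec] by auto
  \<comment> \<open>There is no nonzero morphism \<open>V \<rightarrow> \<Sigma>B\<close>, so \<open>V \<rightarrow> C\<close> factors through \<open>\<Sigma>A\<close>.\<close>
  have "(- susM T b) \<cdot> (e' \<cdot> g) = 0"
    using cmp_in_Hom[OF e'g sb] Hom_simple_shift_coaisle[OF Y j(2) B BP] unfolding V_def by simp
  then obtain v where v: "v \<in> Hom T V (susO T A)" and av: "(- susM T a) \<cdot> v = e' \<cdot> g"
    using tri_lift[OF sdec e'g] by blast
  obtain Z' s' u where t': "(Z', V, susO T A, s', v, u) \<in> tri T" using tri_fibre[OF v] .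
  have s': "s' \<in> Hom T Z' V" and u: "u \<in> Hom T (susO T A) (susO T Z')"
    using tri_in_Hom[OF t'] by auto
  have cone: "s' \<in> cone_in T P Z' V"
    using t' thick_sus[OF RS0_thick AP] unfolding cone_in_def by blast
  \<comment> \<open>\<open>s'\<close> dies in \<open>C\<close>, since \<open>V \<rightarrow> C\<close> factors through \<open>v\<close>; hence \<open>s'\<close> factors through \<open>s\<close>.\<close>
  have "(e' \<cdot> g) \<cdot> s' = 0"
    using av cmp_assoc[OF s' v sa] tri_cmp_zero[OF t'] cmp_zero_right[OF sa] by simp
  then have "e' \<cdot> (g \<cdot> s') = 0" using cmp_assoc[OF s' g e'H] by simp
  then have "g \<cdot> s' = 0"
    using cmp_assoc[OF cmp_in_Hom[OF s' g] e'H eH] ee' cmp_idt_left[OF cmp_in_Hom[OF s' g]]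
      cmp_zero_right[OF eH] by simp
  then obtain r where r: "r \<in> Hom T Z' Z" and sr: "s \<cdot> r = s'" using tri_lift[OF t s'] by blast
  \<comment> \<open>The exact sequence for \<open>Hom(-, X)\<close> is used after one suspension, in the twice rotated triangle.\<close>
  have "X = shiftO T 0 X" by (simp add: shiftO_def)
  then have "X \<in> shifts_nonneg T S" using X unfolding shifts_nonneg_def by blast
  then have "Hom T A X = {0}" using A unfolding left_perp_def by blast
  then have AX: "Hom T (susO T A) (susO T X) = {0}" by (simp add: sus_Hom_zero_iff)
  have VX: "Hom T (susO T V) (susO T X) = {0}"
    using simple_Hom_positive_shift[OF X Y j(1)] unfolding V_def by (simp add: sus_Hom_zero_iff)
  have rot: "(V, susO T A, susO T Z', v, u, - susM T s') \<in> tri T"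
    using t' tri_rotate[OF s' v u] by blast
  then have rot2: "(susO T A, susO T Z', susO T V, u, - susM T s', - susM T v) \<in> tri T"
    using tri_rotate[OF v u uminus_in_Hom[OF sus_in_Hom[OF s']]] by blast
  have "f = 0" if f: "f \<in> Hom T (susO T Z') (susO T X)" for f
  proof -
    have "f \<cdot> u = 0" using cmp_in_Hom[OF u f] AX by simp
    then obtain w where "w \<in> Hom T (susO T V) (susO T X)" and "w \<cdot> (- susM T s') = f"
      using tri_extend[OF rot2 f] by blast
    then show ?thesis using VX cmp_zero_left[OF uminus_in_Hom[OF sus_in_Hom[OF s']]] by simp
  qed
  then have "Hom T (susO T Z') (susO T X) = {0}" by auto
  then have "Hom T Z' X = {0}" by (simp add: sus_Hom_zero_iff)
  then show ?thesis using r sr cone unfolding V_def by blast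
qed

end

theorem corollary4p3:
  fixes T :: "('k::alg_closed_field, 'o, 'm::ab_group_add) tricat"
    and P S :: "'o set" and d j :: nat and X Y :: 'o
  assumes "cy_triple T P S d"
    and "X \<in> S" and "Y \<in> S"
    and "1 \<le> j" and "j \<le> d"
  shows "Verdier_Hom T P (shiftO T (int j) Y) X = {Verdier_zero T P (shiftO T (int j) Y) X}"
proof -
  interpret cy_triple T P S d by fact
  show ?thesis
    unfolding shiftO_int
    using Verdier_Hom_trivial[OF RS0_thick refinement_with_no_map_to_simple[OF assms(2-5)]] .
qed

end
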